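(* Let $\eta\in\mathbb{R}$, $\lambda>-1/2$, $b=\lambda+i\eta$, and consider the weight function on the unit circle $$w(\theta)=\tau(b)\,e^{-\eta\theta}[\sin^2(\theta/2)]^{\lambda},\quad\theta\in[0,2\pi],\qquad \tau(b)=\frac{e^{\pi\eta}\,2^{b+\overline b}\,|\Gamma(b+1)|^2}{2\pi\,\Gamma(b+\overline b+1)}.$$ The associated monic orthogonal polynomials $\Phi_n$, with Verblunsky coefficients $\alpha_n$, satisfy the following structure relations for all $n\ge2$. (i) $$(z-1)\Phi_n'(z)=-(\overline b+n)[1-|\alpha_{n-1}|^2]\Phi_{n-1}(z)+n\Phi_n(z).$$ (ii) For every $r\in\mathbb{C}$, $$(z-1)(z-r)\Phi_n'(z)=n\Phi_{n+1}(z)-[\overline b+n(r+1)]\Phi_n(z)+r(\overline b+n)[1-|\alpha_{n-1}|^2]\Phi_{n-1}(z)-(b+1)\overline{\alpha}_n\Phi_n^*(z).$$ In particular: $$z(z-1)\Phi_n'(z)=n\Phi_{n+1}(z)-(\overline b+n)\Phi_n(z)-(b+1)\overline{\alpha}_n\Phi_n^*(z),$$ $$(z-1)^2\Phi_n'(z)=n\Phi_{n+1}(z)-(\overline b+2n)\Phi_n(z)+(\overline b+n)[1-|\alpha_{n-1}|^2]\Phi_{n-1}(z)-(b+1)\overline{\alpha}_n\Phi_n^*(z),$$ $$(z^2-1)\Phi_n'(z)=n\Phi_{n+1}(z)-\overline b\,\Phi_n(z)-(\overline b+n)[1-|\alpha_{n-1}|^2]\Phi_{n-1}(z)-(b+1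)\overline{\alpha}_n\Phi_n^*(z).$$
   Context: For a weight function $w$ on $[0,2\pi]$, put $\langle f,g\rangle=\int_0^{2\pi}f(e^{i\theta})\overline{g(e^{i\theta})}\,w(\theta)\,d\theta$. The monic orthogonal polynomials on the unit circle $\Phi_n$ ($n\ge0$) are the monic polynomials of degree $n$ with $\langle\Phi_n,z^k\rangle=0$ for $0\le k\le n-1$. The reciprocal polynomial is $\Phi_n^*(z)=z^n\overline{\Phi_n(1/\overline z)}$. The Verblunsky coefficients are $\alpha_{n-1}=-\overline{\Phi_n(0)}$ for $n\ge0$ (so $\alpha_{-1}=-1$). *)

theory Defs
  imports "HOL-Analysis.Analysis" "HOL-Computational_Algebra.Polynomial"
begin

definition circle_inner ::
  "(real \<Rightarrow> real) \<Rightarrow> (complex \<Rightarrow> complex) \<Rightarrow> (complex \<Rightarrow> complex) \<Rightarrow> complex" where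
  "circle_inner w f g =
     (LINT \<theta>:{0..2 * pi}|lborel. f (cis \<theta>) * cnj (g (cis \<theta>)) * complex_of_real (w \<theta>))"

definition monic_opuc :: "(real \<Rightarrow> real) \<Rightarrow> (nat \<Rightarrow> complex poly) \<Rightarrow> bool" where
  "monic_opuc w \<Phi> \<longleftrightarrow>
     (\<forall>n. degree (\<Phi> n) = n \<and> lead_coeff (\<Phi> n) = 1 \<and>
          (\<forall>k<n. circle_inner w (poly (\<Phi> n)) (\<lambda>z. z ^ k) = 0))"

(* The exponent in z^n * cnj (p (1 / cnj z)) is n = degree p; as a polynomial this is also
   correct at z = 0, where HOL's 1 / 0 = 0 makes the formula itself unusable. *)
definition reciprocal_poly :: "complex poly \<Rightarrow> complex poly" where
  "reciprocal_poly p = reflect_poly (map_poly cnj p)"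

lemma poly_reciprocal_poly:
  assumes "z \<noteq> 0"
  shows "poly (reciprocal_poly p) z = z ^ degree p * cnj (poly p (1 / cnj z))"
proof -
  have d: "degree (map_poly cnj p) = degree p"
    by (rule degree_map_poly) simp
  have "poly (map_poly cnj p) (cnj x) = cnj (poly p x)" for x
    by (simp add: poly_altdef d coeff_map_poly)
  from this[of "1 / cnj z"] show ?thesis
    using assms by (simp add: reciprocal_poly_def poly_reflect_poly_nz d inverse_eq_divide)
qed

(* alpha_n = - cnj (Phi_(n+1) (0)); the conventional value alpha_(-1) = -1 has no index here. *)
definition verblunsky :: "(nat \<Rightarrow> complex poly) \<Rightarrow> nat \<Rightarrow> complex" where
  "verblunsky \<Phi> n = - cnj (poly (\<Phi> (Suc n)) 0)"

definition weight_const :: "complex \<Rightarrow> real" where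
  "weight_const b =
     exp (pi * Im b) * 2 powr Re (b + cnj b) * (cmod (Gamma (b + 1)))\<^sup>2
       / (2 * pi * Gamma (Re (b + cnj b + 1)))"

(* With b = lambda + i * eta.  HOL has 0 powr x = 0, so for lambda <= 0 the values at the
   endpoints 0 and 2 * pi are conventional; they form a null set. *)
definition circle_weight :: "complex \<Rightarrow> real \<Rightarrow> real" where
  "circle_weight b \<theta> =
     weight_const b * exp (- Im b * \<theta>) * ((sin (\<theta> / 2))\<^sup>2) powr Re b"

end

theory Submission
  imports Defs
begin

text \<open>
  Write \<open>\<langle>p, q\<rangle>\<close> for the inner product of two polynomials on the circle, \<open>z = cis \<theta>\<close>, and
  \<open>a\<close> for the Verblunsky coefficients. The weight solves a first order equation of Pearson type,
  \<open>(z - 1) w' = \<i> (b z + cnj b) w\<close>. Integrating the \<open>\<theta>\<close>-derivative of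
  \<open>(z - 1) p(z) cnj z ^ k w(\<theta>)\<close> over the circle, where the boundary terms vanish because
  \<open>Re b > - 1/2\<close>, therefore expresses \<open>\<langle>z (z - 1) p', z ^ k\<rangle>\<close> through \<open>\<langle>z p, z ^ k\<rangle>\<close> and
  \<open>\<langle>p, z ^ k\<rangle>\<close> (\<open>circle_weight_integration_by_parts\<close>). For \<open>p = \<Phi> n\<close> the right-hand side is
  zero for all but the extreme values of \<open>k\<close>.

  A polynomial of degree at most \<open>n\<close> that is orthogonal to \<open>1, \<dots>, z ^ n\<close> is zero, because the
  weight is positive. So an identity between polynomials can be checked on moments:
  \<open>(z - 1) \<Phi>' n - n \<Phi> n\<close> is orthogonal to \<open>1, \<dots>, z ^ (n - 2)\<close> and has degree below \<open>n\<close>, so it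
  is a multiple of \<open>\<Phi> (n - 1)\<close> (\<open>structure_relation_backward\<close>); and
  \<open>z (z - 1) \<Phi>' n - n \<Phi> (n + 1)\<close> is orthogonal to \<open>z, \<dots>, z ^ (n - 1)\<close> and has degree at most
  \<open>n\<close>, so it is a combination of \<open>\<Phi> n\<close> and its reciprocal polynomial
  (\<open>structure_relation_forward\<close>). The multipliers come from the moments at the extreme values of
  \<open>k\<close>, once \<open>\<langle>\<Phi> (n+1), \<Phi> (n+1)\<rangle> = (1 - \<bar>a n\<bar>\<^sup>2) \<langle>\<Phi> n, \<Phi> n\<rangle>\<close> and
  \<open>\<langle>z \<Phi> n, 1\<rangle> = cnj (a n) \<langle>\<Phi> n, \<Phi> n\<rangle>\<close> are known; both follow from the Szego recursion. The relation
  with the free parameter \<open>r\<close> is the second identity minus \<open>r\<close> times the first.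
\<close>

section \<open>Polynomials under a positive weight on the circle\<close>

lemma set_integrable_continuous_scaleR:
  fixes f :: "real \<Rightarrow> 'a::{banach, second_countable_topology}" and g :: "real \<Rightarrow> real"
  assumes g: "set_integrable lborel {a..b} g" and f: "continuous_on UNIV f"
  shows "set_integrable lborel {a..b} (\<lambda>x. g x *\<^sub>R f x)"
proof -
  have "compact (f ` {a..b})"
    by (intro compact_continuous_image continuous_on_subset[OF f]) auto
  then obtain B where B: "\<And>x. x \<in> {a..b} \<Longrightarrow> norm (f x) \<le> B"
    using compact_imp_bounded bounded_iff by (metis imageI)
  have ig: "integrable lborel (\<lambda>x. indicator {a..b} x *\<^sub>R g x)"
    using g by (simp add: set_integrable_def)
  have [measurable]: "f \<in> borel_measurable borel"
    using f by (rule borel_measurable_continuous_onI)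
  have mg: "(\<lambda>x. indicator {a..b} x *\<^sub>R g x) \<in> borel_measurable lborel"
    using ig by (rule borel_measurable_integrable)
  have "integrable lborel (\<lambda>x. (indicator {a..b} x *\<^sub>R g x) *\<^sub>R f x)"
  proof (rule Bochner_Integration.integrable_bound[of _ "\<lambda>x. B * (indicator {a..b} x *\<^sub>R g x)"])
    show "integrable lborel (\<lambda>x. B * (indicator {a..b} x *\<^sub>R g x))"
      using ig by (rule integrable_mult_right)
    show "(\<lambda>x. (indicator {a..b} x *\<^sub>R g x) *\<^sub>R f x) \<in> borel_measurable lborel"
      by (rule borel_measurable_scaleR[OF mg]) simp
    show "AE x in lborel. norm ((indicator {a..b} x *\<^sub>R g x) *\<^sub>R f x)
        \<le> norm (B * (indicator {a..b} x *\<^sub>R g x))"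
    proof (rule AE_I2)
      fix x
      show "norm ((indicator {a..b} x *\<^sub>R g x) *\<^sub>R f x) \<le> norm (B * (indicator {a..b} x *\<^sub>R g x))"
      proof (cases "x \<in> {a..b}")
        case True
        have "norm (f x) \<le> \<bar>B\<bar>" using B[OF True] by linarith
        then have "\<bar>g x\<bar> * norm (f x) \<le> \<bar>g x\<bar> * \<bar>B\<bar>" by (intro mult_left_mono) auto
        then show ?thesis using True by (simp add: abs_mult mult.commute)
      qed simp
    qed
  qed
  then show ?thesis by (simp add: set_integrable_def)
qed

locale positive_circle_weight =
  fixes w :: "real \<Rightarrow> real"
  assumes integrable_weight: "set_integrable lborel {0..2 * pi} w"
    and weight_pos: "\<And>\<theta>. 0 < \<theta> \<Longrightarrow> \<theta> < 2 * pi \<Longrightarrow> w \<theta> > 0"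
    and weight_nonneg: "\<And>\<theta>. w \<theta> \<ge> 0"
begin

definition ip :: "complex poly \<Rightarrow> complex poly \<Rightarrow> complex" where
  "ip p q = circle_inner w (poly p) (poly q)"

lemma integrable_times_weight:
  assumes "continuous_on UNIV f"
  shows "set_integrable lborel {0..2 * pi} (\<lambda>\<theta>. f \<theta> * complex_of_real (w \<theta>))"
  using set_integrable_continuous_scaleR[OF integrable_weight assms]
  by (simp add: scaleR_conv_of_real mult.commute)

lemma integrable_ip:
  "set_integrable lborel {0..2 * pi}
     (\<lambda>\<theta>. poly p (cis \<theta>) * cnj (poly q (cis \<theta>)) * complex_of_real (w \<theta>))"
  by (intro integrable_times_weight continuous_intros)

lemma ip_add_left: "ip (p + q) r = ip p r + ip q r"
  unfolding ip_def circle_inner_def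
  by (subst set_integral_add(2)[symmetric, OF integrable_ip integrable_ip])
     (simp add: algebra_simps)

lemma ip_smult_left: "ip (smult c p) r = c * ip p r"
  unfolding ip_def circle_inner_def
  by (subst set_integral_mult_right[symmetric]) (simp add: mult_ac)

lemma ip_cnj: "ip q p = cnj (ip p q)"
proof -
  have "cnj (LINT \<theta>:{0..2 * pi}|lborel.
          poly p (cis \<theta>) * cnj (poly q (cis \<theta>)) * complex_of_real (w \<theta>))
      = (LINT \<theta>:{0..2 * pi}|lborel.
          cnj (poly p (cis \<theta>) * cnj (poly q (cis \<theta>)) * complex_of_real (w \<theta>)))"
    unfolding set_lebesgue_integral_def
    by (simp only: Bochner_Integration.integral_cnj[symmetric] complex_cnj_scaleR)
  then show ?thesis
    unfolding ip_def circle_inner_def by (simp add: mult_ac)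
qed

lemma ip_diff_left: "ip (p - q) r = ip p r - ip q r"
  using ip_add_left[of p "smult (-1) q" r] ip_smult_left[of "-1" q r] by simp

lemma ip_add_right: "ip r (p + q) = ip r p + ip r q"
  by (metis ip_cnj ip_add_left complex_cnj_add)

lemma ip_smult_right: "ip r (smult c p) = cnj c * ip r p"
  by (metis ip_cnj ip_smult_left complex_cnj_mult)

lemma ip_sum_right: "ip r (\<Sum>i\<in>A. f i) = (\<Sum>i\<in>A. ip r (f i))"
proof (induction A rule: infinite_finite_induct)
  case (insert x F)
  then show ?case by (simp add: ip_add_right)
qed (use ip_smult_right[of r 0 0] in simp_all)

text \<open>On the unit circle \<open>z * cnj z = 1\<close>, so multiplication by \<open>z\<close> is an isometry.\<close>

lemma ip_pCons_pCons: "ip (pCons 0 p) (pCons 0 q) = ip p q"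
proof -
  have "poly (pCons 0 p) (cis \<theta>) * cnj (poly (pCons 0 q) (cis \<theta>))
      = (cis \<theta> * cnj (cis \<theta>)) * (poly p (cis \<theta>) * cnj (poly q (cis \<theta>)))" for \<theta>
    by (simp add: mult_ac)
  also have "(cis \<theta> * cnj (cis \<theta>)) * (poly p (cis \<theta>) * cnj (poly q (cis \<theta>))) = poly p (cis \<theta>) * cnj (poly q (cis \<theta>))" for \<theta>
    by (simp add: cis_cnj cis_mult)
  finally show ?thesis
    unfolding ip_def circle_inner_def by (simp only:)
qed

lemma ip_monom_Suc: "ip (pCons 0 p) (monom 1 (Suc k)) = ip p (monom 1 k)"
  by (simp add: monom_Suc ip_pCons_pCons)

text \<open>On the unit circle \<open>reciprocal_poly p\<close> is \<open>z ^ degree p\<close> times the complex conjugate of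
  \<open>p\<close>, so its moments are those of \<open>p\<close> in reverse order, conjugated.\<close>

lemma ip_reciprocal:
  "ip (reciprocal_poly p) (monom 1 k) = ip (monom 1 (degree p)) (monom 1 k * p)"
proof -
  have "poly (reciprocal_poly p) (cis \<theta>) = cis \<theta> ^ degree p * cnj (poly p (cis \<theta>))" for \<theta>
    by (subst poly_reciprocal_poly) (simp_all add: cis_cnj divide_conv_cnj)
  then show ?thesis
    unfolding ip_def circle_inner_def by (simp add: poly_monom mult_ac)
qed

text \<open>A nonzero polynomial has finitely many zeros on the circle, so \<open>\<bar>p\<bar>\<^sup>2 w\<close> is positive almost
  everywhere unless \<open>p = 0\<close>.\<close>

lemma ip_definite:
  assumes "ip p p = 0"
  shows "p = 0"
proof (rule ccontr)
  assume "p \<noteq> 0"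
  let ?f = "\<lambda>\<theta>. (cmod (poly p (cis \<theta>)))\<^sup>2 * w \<theta>"
  have eq: "poly p (cis \<theta>) * cnj (poly p (cis \<theta>)) * complex_of_real (w \<theta>) = complex_of_real (?f \<theta>)"
    for \<theta> by (simp add: complex_norm_square[symmetric] del: of_real_power)
  have "integrable lborel (\<lambda>\<theta>. complex_of_real (indicator {0..2 * pi} \<theta> *\<^sub>R ?f \<theta>))"
    using integrable_ip[of p p] unfolding eq set_integrable_def
    by (simp add: scaleR_conv_of_real)
  then have int: "integrable lborel (\<lambda>\<theta>. indicator {0..2 * pi} \<theta> *\<^sub>R ?f \<theta>)"
    by (simp only: complex_of_real_integrable_eq)
  have "complex_of_real (LINT \<theta>|lborel. indicator {0..2 * pi} \<theta> *\<^sub>R ?f \<theta>) = 0"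
    using assms unfolding ip_def circle_inner_def eq set_lebesgue_integral_def
    by (simp add: scaleR_conv_of_real flip: integral_complex_of_real)
  then have "(LINT \<theta>|lborel. indicator {0..2 * pi} \<theta> *\<^sub>R ?f \<theta>) = 0"
    by (simp only: of_real_eq_0_iff)
  then have ae: "AE \<theta> in lborel. indicator {0..2 * pi} \<theta> *\<^sub>R ?f \<theta> = 0"
    by (subst (asm) integral_nonneg_eq_0_iff_AE[OF int]) (auto simp: weight_nonneg)
  \<comment> \<open>On the open interval \<open>cis\<close> is injective, so only finitely many angles meet a root of \<open>p\<close>.\<close>
  have "finite {\<theta>\<in>{0<..<2 * pi}. poly p (cis \<theta>) = 0}"
  proof (rule finite_imageD)
    show "finite (cis ` {\<theta>\<in>{0<..<2 * pi}. poly p (cis \<theta>) = 0})"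
      by (rule finite_subset[OF _ poly_roots_finite[OF \<open>p \<noteq> 0\<close>]]) auto
    show "inj_on cis {\<theta>\<in>{0<..<2 * pi}. poly p (cis \<theta>) = 0}"
    proof (rule inj_onI)
      fix x y :: real
      assume "x \<in> {\<theta>\<in>{0<..<2 * pi}. poly p (cis \<theta>) = 0}"
        "y \<in> {\<theta>\<in>{0<..<2 * pi}. poly p (cis \<theta>) = 0}" and eq: "cis x = cis y"
      then have xy: "0 < x" "x < 2 * pi" "0 < y" "y < 2 * pi" by auto
      have "cos x = cos y" "sin x = sin y" using eq by (auto simp: complex_eq_iff)
      then have "cos (x - y) = 1" by (simp add: cos_diff flip: power2_eq_square)
      then obtain n :: int where "x - y = of_int n * 2 * pi"
        by (auto simp: cos_one_2pi_int)
      moreover have "\<bar>x - y\<bar> < 2 * pi" using xy by linarith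
      ultimately have "\<bar>of_int n * 2 * pi\<bar> < 2 * pi" by (simp only:)
      then have "\<bar>of_int n\<bar> * (2 * pi) < 1 * (2 * pi)" by (simp add: abs_mult)
      then have "\<bar>of_int n :: real\<bar> < 1" by (rule mult_right_less_imp_less) simp
      then have "n = 0" by linarith
      with \<open>x - y = of_int n * 2 * pi\<close> show "x = y" by simp
    qed
  qed
  then have "AE \<theta> in lborel. \<theta> \<notin> {\<theta>\<in>{0<..<2 * pi}. poly p (cis \<theta>) = 0}"
    by (intro AE_not_in finite_imp_null_set_lborel)
  with ae have "AE \<theta> in lborel. \<theta> \<notin> {0<..<2 * pi}"
  proof eventually_elim
    case (elim \<theta>)
    then show ?case
      using weight_pos[of \<theta>] by (auto simp: indicator_def)
  qed
  then have "emeasure lborel {0<..<2 * pi :: real} = 0"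
    by (subst (asm) AE_iff_measurable[OF _ refl]) (auto simp: greaterThanLessThan_def Int_def)
  then show False by simp
qed

lemma ip_poly_right:
  assumes "degree q \<le> n"
  shows "ip p q = (\<Sum>k\<le>n. cnj (coeff q k) * ip p (monom 1 k))"
proof -
  have "q = (\<Sum>k\<le>n. smult (coeff q k) (monom 1 k))"
    using poly_as_sum_of_monoms'[OF assms] by (simp add: smult_monom)
  then have "ip p q = ip p (\<Sum>k\<le>n. smult (coeff q k) (monom 1 k))" by simp
  then show ?thesis by (simp add: ip_sum_right ip_smult_right)
qed

text \<open>The tool for proving polynomial identities from moments: \<open>ip E E\<close> is a combination of the products
  \<open>cnj (coeff E k) * ip E (z ^ k)\<close>, so for each \<open>k\<close> it suffices that one factor vanishes.\<close>

lemma poly_eq_0_if_coeff_or_moment_0: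
  assumes "degree E \<le> n"
    and "\<And>k. k \<le> n \<Longrightarrow> coeff E k = 0 \<or> ip E (monom 1 k) = 0"
  shows "E = 0"
proof (rule ip_definite)
  show "ip E E = 0"
    unfolding ip_poly_right[OF assms(1)] by (intro sum.neutral) (use assms(2) in auto)
qed

end

section \<open>Szego recursion and norms\<close>

locale circle_orthogonal_polys = positive_circle_weight +
  fixes \<Phi> :: "nat \<Rightarrow> complex poly"
  assumes opuc: "monic_opuc w \<Phi>"
begin

definition norm2 :: "nat \<Rightarrow> complex" where
  "norm2 n = ip (\<Phi> n) (\<Phi> n)"

lemma degree_\<Phi> [simp]: "degree (\<Phi> n) = n"
  using opuc by (simp add: monic_opuc_def)

lemma coeff_\<Phi> [simp]: "coeff (\<Phi> n) n = 1"
  using opuc by (metis degree_\<Phi> monic_opuc_def)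

lemma \<Phi>_orthogonal: "k < n \<Longrightarrow> ip (\<Phi> n) (monom 1 k) = 0"
  using opuc by (simp add: monic_opuc_def ip_def poly_monom[abs_def])

lemma ip_\<Phi>_poly:
  assumes "degree q \<le> n"
  shows "ip (\<Phi> n) q = cnj (coeff q n) * ip (\<Phi> n) (monom 1 n)"
proof -
  have "ip (\<Phi> n) q = (\<Sum>k\<le>n. cnj (coeff q k) * ip (\<Phi> n) (monom 1 k))"
    using assms by (rule ip_poly_right)
  also have "\<dots> = (\<Sum>k\<in>{n}. cnj (coeff q k) * ip (\<Phi> n) (monom 1 k))"
    by (rule sum.mono_neutral_right) (auto simp: \<Phi>_orthogonal)
  finally show ?thesis by simp
qed

lemma ip_\<Phi>_monom_same: "ip (\<Phi> n) (monom 1 n) = norm2 n"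
  using ip_\<Phi>_poly[of "\<Phi> n" n] by (simp add: norm2_def)

lemma cnj_norm2 [simp]: "cnj (norm2 n) = norm2 n"
  by (simp add: norm2_def flip: ip_cnj)

lemma degree_reciprocal_\<Phi>: "degree (reciprocal_poly (\<Phi> n)) \<le> n"
proof -
  have "degree (map_poly cnj (\<Phi> n)) = n"
    by (subst degree_map_poly) auto
  then show ?thesis
    unfolding reciprocal_poly_def using degree_reflect_poly_le by metis
qed

lemma reciprocal_\<Phi>_at_0: "coeff (reciprocal_poly (\<Phi> n)) 0 = 1"
proof -
  have "degree (map_poly cnj (\<Phi> n)) = n"
    by (subst degree_map_poly) auto
  then show ?thesis
    by (simp add: reciprocal_poly_def coeff_map_poly)
qed

lemma ip_shift: "j \<le> k \<Longrightarrow> ip (monom 1 k) (monom 1 j * q) = ip (monom 1 (k - j)) q"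
proof (induction j arbitrary: k)
  case (Suc j)
  then obtain k' where k: "k = Suc k'" by (cases k) auto
  have "monom 1 (Suc j) * q = pCons 0 (monom 1 j * q)"
    by (simp add: monom_Suc)
  then show ?case
    using Suc by (simp add: k monom_Suc ip_pCons_pCons)
qed (simp add: one_poly_eq_simps)

lemma ip_reciprocal_\<Phi>:
  assumes "k \<le> n"
  shows "ip (reciprocal_poly (\<Phi> n)) (monom 1 k) = (if k = 0 then norm2 n else 0)"
proof -
  have "ip (reciprocal_poly (\<Phi> n)) (monom 1 k) = cnj (ip (\<Phi> n) (monom 1 (n - k)))"
    using assms by (simp add: ip_reciprocal ip_shift flip: ip_cnj)
  then show ?thesis
    using assms by (auto simp: \<Phi>_orthogonal ip_\<Phi>_monom_same)
qed

text \<open>Both \<open>\<Phi> (n+1) - z \<Phi> n\<close> and \<open>reciprocal_poly (\<Phi> n)\<close> have degree at most \<open>n\<close> and are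
  orthogonal to \<open>z, \<dots>, z ^ n\<close>; hence they are proportional, and the values at \<open>0\<close> give the
  factor.\<close>

lemma szego_recursion:
  "\<Phi> (Suc n) = pCons 0 (\<Phi> n) - smult (cnj (verblunsky \<Phi> n)) (reciprocal_poly (\<Phi> n))"
proof -
  define E where
    "E = \<Phi> (Suc n) - pCons 0 (\<Phi> n) + smult (cnj (verblunsky \<Phi> n)) (reciprocal_poly (\<Phi> n))"
  have "E = 0"
  proof (rule poly_eq_0_if_coeff_or_moment_0)
    show "degree E \<le> Suc n"
      unfolding E_def
      by (intro degree_add_le degree_diff_le order_trans[OF degree_smult_le]
            order_trans[OF degree_pCons_le] le_SucI[OF degree_reciprocal_\<Phi>]) auto
    fix k assume k: "k \<le> Suc n"
    show "coeff E k = 0 \<or> ip E (monom 1 k) = 0"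
    proof (cases "k = 0 \<or> k = Suc n")
      case True
      have "coeff (reciprocal_poly (\<Phi> n)) (Suc n) = 0"
        using degree_reciprocal_\<Phi>[of n] by (intro coeff_eq_0) simp
      with True have "coeff E k = 0"
        by (auto simp: E_def verblunsky_def reciprocal_\<Phi>_at_0 poly_0_coeff_0)
      then show ?thesis by simp
    next
      case False
      with k obtain j where j: "k = Suc j" "j < n" by (cases k) auto
      have "ip E (monom 1 k) = 0"
        unfolding E_def ip_add_left ip_diff_left ip_smult_left
        using j ip_monom_Suc[of "\<Phi> n" j] by (simp add: \<Phi>_orthogonal ip_reciprocal_\<Phi>)
      then show ?thesis by simp
    qed
  qed
  then show ?thesis by (simp add: E_def algebra_simps)
qed

lemma ip_shifted_\<Phi>_1: "ip (pCons 0 (\<Phi> n)) (monom 1 0) = cnj (verblunsky \<Phi> n) * norm2 n"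
proof -
  have "pCons 0 (\<Phi> n) = \<Phi> (Suc n) + smult (cnj (verblunsky \<Phi> n)) (reciprocal_poly (\<Phi> n))"
    by (subst szego_recursion) simp
  then show ?thesis
    by (simp only: ip_add_left ip_smult_left)
       (simp add: \<Phi>_orthogonal ip_reciprocal_\<Phi> del: monom_0 monom_eq_1)
qed

text \<open>Pair the Szego recursion with \<open>z ^ (n+1)\<close>: the reciprocal polynomial contributes the
  conjugate of \<open>\<langle>z \<Phi> n, 1\<rangle>\<close>.\<close>

lemma norm2_Suc: "norm2 (Suc n) = (1 - of_real ((cmod (verblunsky \<Phi> n))\<^sup>2)) * norm2 n"
proof -
  let ?a = "verblunsky \<Phi> n" and ?S = "reciprocal_poly (\<Phi> n)"
  have "ip ?S (monom 1 (Suc n)) = ip (monom 1 n) (monom 1 (Suc n) * \<Phi> n)"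
    by (simp add: ip_reciprocal)
  also have "monom 1 (Suc n) * \<Phi> n = monom 1 n * pCons 0 (\<Phi> n)"
    by (simp add: monom_Suc)
  also have "ip (monom 1 n) \<dots> = cnj (ip (pCons 0 (\<Phi> n)) (monom 1 0))"
    by (subst ip_shift) (simp_all flip: ip_cnj)
  also have "\<dots> = ?a * norm2 n"
    by (simp only: ip_shifted_\<Phi>_1) simp
  finally have S: "ip ?S (monom 1 (Suc n)) = ?a * norm2 n" .
  have "norm2 (Suc n) = ip (\<Phi> (Suc n)) (monom 1 (Suc n))"
    by (simp add: ip_\<Phi>_monom_same)
  also have "\<dots> = norm2 n - cnj ?a * (?a * norm2 n)"
    by (subst szego_recursion)
       (simp only: ip_diff_left ip_smult_left ip_monom_Suc ip_\<Phi>_monom_same S)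
  also have "\<dots> = (1 - ?a * cnj ?a) * norm2 n" by (simp add: algebra_simps)
  finally show ?thesis by (simp only: complex_norm_square)
qed

end

section \<open>Structure relations from the Pearson equation\<close>

text \<open>The weak form of the Pearson equation \<open>(z - 1) w' = \<i> (b z + cnj b) w\<close>, in which \<open>w'\<close> is the
  derivative in \<open>\<theta>\<close> and \<open>z = cis \<theta>\<close>.\<close>

locale pearson_orthogonal_polys = circle_orthogonal_polys +
  fixes b :: complex
  assumes pearson: "\<And>p k. ip ([:0, -1, 1:] * pderiv p) (monom 1 k)
      = (of_nat k - 1 - b) * ip (pCons 0 p) (monom 1 k) - (of_nat k + cnj b) * ip p (monom 1 k)"
begin

text \<open>The moments of \<open>(z - 1) \<Phi>' n\<close> below \<open>n - 1\<close> vanish. At \<open>k = n - 1\<close> the moment is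
  \<open>- (n + cnj b) * norm2 n\<close>, which \<open>norm2_Suc\<close> turns into a multiple of \<open>norm2 (n - 1)\<close>.\<close>

lemma structure_relation_backward:
  "[:-1, 1:] * pderiv (\<Phi> (Suc m)) =
     smult (of_nat (Suc m)) (\<Phi> (Suc m))
     - smult ((cnj b + of_nat (Suc m)) * (1 - of_real ((cmod (verblunsky \<Phi> m))\<^sup>2))) (\<Phi> m)"
proof -
  let ?n = "Suc m" and ?c = "1 - complex_of_real ((cmod (verblunsky \<Phi> m))\<^sup>2)"
  define E where "E = [:-1, 1:] * pderiv (\<Phi> ?n) - smult (of_nat ?n) (\<Phi> ?n)
      + smult ((cnj b + of_nat ?n) * ?c) (\<Phi> m)"
  have dp: "degree (pderiv (\<Phi> ?n)) = m"
    by (simp add: degree_pderiv)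
  have "E = 0"
  proof (rule poly_eq_0_if_coeff_or_moment_0)
    show "degree E \<le> ?n"
      unfolding E_def
      by (intro degree_add_le degree_diff_le order_trans[OF degree_smult_le]
            order_trans[OF degree_mult_le]) (simp_all add: dp)
    fix k assume k: "k \<le> ?n"
    show "coeff E k = 0 \<or> ip E (monom 1 k) = 0"
    proof (cases "k = ?n")
      case True
      have "coeff (pderiv (\<Phi> ?n)) ?n = 0" "coeff (pderiv (\<Phi> ?n)) m = of_nat ?n"
        "coeff (\<Phi> m) ?n = 0"
        using coeff_\<Phi>[of ?n] by (auto simp: coeff_eq_0 dp coeff_pderiv simp del: coeff_\<Phi>)
      then have "coeff E k = 0"
        unfolding E_def by (simp add: True)
      then show ?thesis by simp
    next
      case False
      with k have k: "k \<le> m" by simp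
      \<comment> \<open>Multiplying both entries by \<open>z\<close> brings the product into the form of the Pearson equation.\<close>
      have "ip ([:-1, 1:] * pderiv (\<Phi> ?n)) (monom 1 k)
          = ip ([:0, -1, 1:] * pderiv (\<Phi> ?n)) (monom 1 (Suc k))"
        by (subst ip_monom_Suc[symmetric]) simp
      also have "\<dots> = - (of_nat (Suc k) + cnj b) * ip (\<Phi> ?n) (monom 1 (Suc k))"
        using k by (simp only: pearson ip_monom_Suc) (simp add: \<Phi>_orthogonal algebra_simps)
      finally have D: "ip ([:-1, 1:] * pderiv (\<Phi> ?n)) (monom 1 k) =
        - (of_nat (Suc k) + cnj b) * ip (\<Phi> ?n) (monom 1 (Suc k))" .
      have "ip E (monom 1 k) = - (of_nat (Suc k) + cnj b) * ip (\<Phi> ?n) (monom 1 (Suc k))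
          + (cnj b + of_nat ?n) * ?c * ip (\<Phi> m) (monom 1 k)"
        unfolding E_def ip_add_left ip_diff_left ip_smult_left D
        using k by (simp add: \<Phi>_orthogonal)
      also have "\<dots> = 0"
      proof (cases "k = m")
        case True
        then show ?thesis
          by (simp only: ip_\<Phi>_monom_same norm2_Suc) (simp add: algebra_simps)
      qed (use k in \<open>simp add: \<Phi>_orthogonal\<close>)
      finally show ?thesis by simp
    qed
  qed
  then show ?thesis by (simp add: E_def algebra_simps)
qed

text \<open>Here the two extreme moments decide the multipliers: \<open>k = n\<close> sees only \<open>\<Phi> n\<close>, and
  \<open>k = 0\<close>, where the Pearson equation leaves \<open>- (b + 1) \<langle>z \<Phi> n, 1\<rangle>\<close>, sees only the reciprocal
  polynomial.\<close>

lemma structure_relation_forward: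
  assumes "n > 0"
  shows "[:0, -1, 1:] * pderiv (\<Phi> n) =
     smult (of_nat n) (\<Phi> (Suc n)) - smult (cnj b + of_nat n) (\<Phi> n)
     - smult ((b + 1) * cnj (verblunsky \<Phi> n)) (reciprocal_poly (\<Phi> n))"
proof -
  let ?a = "cnj (verblunsky \<Phi> n)" and ?S = "reciprocal_poly (\<Phi> n)"
  define E where "E = [:0, -1, 1:] * pderiv (\<Phi> n) - smult (of_nat n) (\<Phi> (Suc n))
      + smult (cnj b + of_nat n) (\<Phi> n) + smult ((b + 1) * ?a) ?S"
  have dp: "degree (pderiv (\<Phi> n)) = n - 1"
    by (simp add: degree_pderiv)
  have "E = 0"
  proof (rule poly_eq_0_if_coeff_or_moment_0)
    show "degree E \<le> Suc n"
      unfolding E_def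
      by (intro degree_add_le degree_diff_le order_trans[OF degree_smult_le]
            order_trans[OF degree_mult_le] le_SucI[OF degree_reciprocal_\<Phi>])
         (use assms in \<open>simp_all add: dp\<close>)
    fix k assume k: "k \<le> Suc n"
    show "coeff E k = 0 \<or> ip E (monom 1 k) = 0"
    proof (cases "k = Suc n")
      case True
      obtain m where m: "n = Suc m" using assms by (cases n) auto
      have "coeff (pderiv (\<Phi> n)) n = 0" "coeff (pderiv (\<Phi> n)) (Suc n) = 0"
        "coeff (pderiv (\<Phi> n)) m = of_nat n"
        "coeff (\<Phi> n) (Suc n) = 0" "coeff ?S (Suc n) = 0"
        using coeff_\<Phi>[of n] degree_reciprocal_\<Phi>[of n] assms
        by (auto simp: coeff_eq_0 dp coeff_pderiv m simp del: coeff_\<Phi>)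
      then have "coeff E k = 0"
        unfolding E_def by (simp add: True m coeff_pCons)
      then show ?thesis by simp
    next
      case False
      with k have k: "k \<le> n" by simp
      have "ip E (monom 1 k) = (of_nat k - 1 - b) * ip (pCons 0 (\<Phi> n)) (monom 1 k)
          + (of_nat n - of_nat k) * ip (\<Phi> n) (monom 1 k)
          + (b + 1) * ?a * (if k = 0 then norm2 n else 0)"
        unfolding E_def ip_add_left ip_diff_left ip_smult_left pearson
        using k by (simp add: \<Phi>_orthogonal ip_reciprocal_\<Phi> algebra_simps del: monom_0 monom_eq_1)
      also have "(of_nat n - of_nat k) * ip (\<Phi> n) (monom 1 k) = 0"
        using k by (cases "k = n") (simp_all add: \<Phi>_orthogonal)
      also have "(of_nat k - 1 - b) * ip (pCons 0 (\<Phi> n)) (monom 1 k) + 0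
          + (b + 1) * ?a * (if k = 0 then norm2 n else 0) = 0"
      proof (cases k)
        case 0
        then show ?thesis
          by (simp only: ip_shifted_\<Phi>_1) (simp add: algebra_simps)
      next
        case (Suc j)
        then show ?thesis
          using k by (simp only: ip_monom_Suc) (simp add: \<Phi>_orthogonal)
      qed
      finally show ?thesis by simp
    qed
  qed
  then show ?thesis by (simp add: E_def algebra_simps)
qed

end

section \<open>The weight\<close>

lemma continuous_on_sine_powr:
  fixes r :: real
  assumes "r > 0"
  shows "continuous_on S (\<lambda>\<theta>::real. ((sin (\<theta> / 2))\<^sup>2) powr r)"
  by (rule continuous_on_powr') (use assms in \<open>auto intro!: continuous_intros\<close>)

text \<open>For \<open>l < 0\<close> the power is singular at both endpoints. With \<open>s = sin (\<theta>/2)\<close>,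
  \<open>(l + 1/2) (s\<^sup>2) powr l\<close> is the derivative of \<open>cos (\<theta>/2) * (s\<^sup>2) powr (l + 1/2)\<close>, which is
  continuous, plus the continuous function \<open>(l + 1) (s\<^sup>2) powr (l + 1)\<close>. A nonnegative function
  with a continuous antiderivative is integrable.\<close>

lemma integrable_sine_powr:
  fixes l :: real
  assumes l: "l > - 1 / 2"
  shows "set_integrable lborel {0..2 * pi} (\<lambda>\<theta>. ((sin (\<theta> / 2))\<^sup>2) powr l)"
proof -
  let ?P = "\<lambda>\<theta>. ((sin (\<theta> / 2))\<^sup>2) powr l" and ?I = "{0..2 * pi}"
  let ?h = "\<lambda>\<theta>. (l + 1) * ((sin (\<theta> / 2))\<^sup>2) powr (l + 1)"
  let ?G = "\<lambda>\<theta>. - cos (\<theta> / 2) * ((sin (\<theta> / 2))\<^sup>2) powr (l + 1 / 2)"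
  have "continuous_on ?I ?h"
    using l by (intro continuous_intros continuous_on_sine_powr) auto
  then obtain H where H: "\<And>x. x \<in> ?I \<Longrightarrow> (H has_vector_derivative ?h x) (at x within ?I)"
    using antiderivative_continuous[of 0 "2 * pi" ?h] by blast
  define F where "F = (\<lambda>\<theta>. H \<theta> - ?G \<theta>)"
  have "((\<lambda>\<theta>. (l + 1 / 2) * ?P \<theta>) has_integral F (2 * pi) - F 0) ?I"
  proof (rule fundamental_theorem_of_calculus_interior)
    have "continuous_on ?I H"
      using H by (meson has_vector_derivative_continuous continuous_on_eq_continuous_within)
    then show "continuous_on ?I F"
      unfolding F_def using l by (intro continuous_intros continuous_on_sine_powr) auto
    fix x assume x: "x \<in> {0<..<2 * pi}"
    let ?s = "sin (x / 2)" and ?c = "cos (x / 2)"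
    have s: "?s > 0" using x by (intro sin_gt_zero) auto
    then have s2: "?s\<^sup>2 > 0" by simp
    have "at x within ?I = at x"
      using x by (intro at_within_interior) (simp add: interior_atLeastAtMost_real)
    with H[of x] x have H': "(H has_real_derivative ?h x) (at x)"
      by (simp add: has_real_derivative_iff_has_vector_derivative)
    have "((\<lambda>\<theta>. (sin (\<theta> / 2))\<^sup>2) has_real_derivative ?s * ?c) (at x)"
      by (auto intro!: derivative_eq_intros)
    from DERIV_fun_powr[OF this s2, of "l + 1 / 2"]
    have D: "((\<lambda>\<theta>. ((sin (\<theta> / 2))\<^sup>2) powr (l + 1 / 2)) has_real_derivative
        (l + 1 / 2) * (?s\<^sup>2) powr (l - 1 / 2) * (?s * ?c)) (at x)" by simp
    have Gd: "(?G has_real_derivative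
        ?s / 2 * (?s\<^sup>2) powr (l + 1 / 2)
        - ?c * ((l + 1 / 2) * (?s\<^sup>2) powr (l - 1 / 2) * (?s * ?c))) (at x)"
      by (rule derivative_eq_intros D refl | simp)+
    have p1: "(?s\<^sup>2) powr (l + 1 / 2) = ?P x * ?s"
      using s by (simp add: powr_add)
    have p2: "(?s\<^sup>2) powr (l - 1 / 2) = ?P x / ?s"
      using s by (simp add: powr_diff)
    have p3: "(?s\<^sup>2) powr (l + 1) = ?P x * ?s\<^sup>2"
      using s by (simp add: powr_add)
    have alg: "(l + 1) * (P * s\<^sup>2) - (s / 2 * (P * s) - c * ((l + 1 / 2) * (P / s) * (s * c)))
        = (l + 1 / 2) * P * (s\<^sup>2 + c\<^sup>2)" if "s \<noteq> 0" for P s c :: real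
      using that by (simp add: field_simps power2_eq_square)
    have "?h x - (?s / 2 * (?s\<^sup>2) powr (l + 1 / 2)
        - ?c * ((l + 1 / 2) * (?s\<^sup>2) powr (l - 1 / 2) * (?s * ?c)))
        = (l + 1 / 2) * ?P x * (?s\<^sup>2 + ?c\<^sup>2)"
      unfolding p1 p2 p3 by (rule alg) (use s in simp)
    also have "\<dots> = (l + 1 / 2) * ?P x" by simp
    finally have "(F has_real_derivative (l + 1 / 2) * ?P x) (at x)"
      unfolding F_def using DERIV_diff[OF H' Gd] by simp
    then show "(F has_vector_derivative (l + 1 / 2) * ?P x) (at x)"
      by (simp add: has_real_derivative_iff_has_vector_derivative)
  qed simp
  then have "((\<lambda>\<theta>. (l + 1 / 2) * ?P \<theta>) absolutely_integrable_on ?I)"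
    using l by (intro nonnegative_absolutely_integrable_1) auto
  then have "?P absolutely_integrable_on ?I"
    using l by simp
  then have "integrable (completion lborel) (\<lambda>\<theta>. indicator ?I \<theta> *\<^sub>R ?P \<theta>)"
    by (simp add: set_integrable_def)
  moreover have "(\<lambda>\<theta>. indicator ?I \<theta> *\<^sub>R ?P \<theta>) \<in> borel_measurable lborel"
    by measurable
  ultimately show ?thesis
    unfolding set_integrable_def by (subst (asm) integrable_completion)
qed

lemma weight_const_pos:
  assumes "Re b > - 1 / 2"
  shows "weight_const b > 0"
proof -
  have "b + 1 \<notin> \<int>\<^sub>\<le>\<^sub>0"
    using assms by (auto elim!: nonpos_Ints_cases simp: complex_eq_iff)
  then have "Gamma (b + 1) \<noteq> 0"
    by (simp add: Gamma_eq_zero_iff)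
  moreover have "Gamma (Re (b + cnj b + 1)) > 0"
    using assms by (intro Gamma_real_pos) simp
  ultimately show ?thesis
    unfolding weight_const_def by (intro divide_pos_pos mult_pos_pos) auto
qed

lemma positive_circle_weight_circle_weight:
  assumes "Re b > - 1 / 2"
  shows "positive_circle_weight (circle_weight b)"
proof
  have "set_integrable lborel {0..2 * pi}
      (\<lambda>\<theta>. ((sin (\<theta> / 2))\<^sup>2) powr Re b *\<^sub>R (weight_const b * exp (- Im b * \<theta>)))"
    by (intro set_integrable_continuous_scaleR integrable_sine_powr assms continuous_intros)
  then show "set_integrable lborel {0..2 * pi} (circle_weight b)"
    by (simp add: circle_weight_def[abs_def] mult_ac)
next
  fix \<theta> :: real
  assume "0 < \<theta>" "\<theta> < 2 * pi"
  then have "sin (\<theta> / 2) > 0" by (intro sin_gt_zero) auto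
  then show "circle_weight b \<theta> > 0"
    using weight_const_pos[OF assms] by (simp add: circle_weight_def)
next
  fix \<theta> show "circle_weight b \<theta> \<ge> 0"
    using weight_const_pos[OF assms] by (simp add: circle_weight_def)
qed

lemma circle_weight_DERIV:
  assumes "0 < \<theta>" "\<theta> < 2 * pi"
  shows "(circle_weight b has_real_derivative
      circle_weight b \<theta> * (Re b * cos (\<theta> / 2) / sin (\<theta> / 2) - Im b)) (at \<theta>)"
proof -
  let ?s = "sin (\<theta> / 2)" and ?c = "cos (\<theta> / 2)"
  have s: "?s > 0" using assms by (intro sin_gt_zero) auto
  then have s2: "?s\<^sup>2 > 0" by simp
  have "((\<lambda>\<theta>. (sin (\<theta> / 2))\<^sup>2) has_real_derivative ?s * ?c) (at \<theta>)"
    by (auto intro!: derivative_eq_intros)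
  from DERIV_fun_powr[OF this s2, of "Re b"]
  have D: "((\<lambda>\<theta>. ((sin (\<theta> / 2))\<^sup>2) powr Re b) has_real_derivative
      Re b * (?s\<^sup>2) powr (Re b - 1) * (?s * ?c)) (at \<theta>)" by simp
  have p: "(?s\<^sup>2) powr (Re b - 1) = (?s\<^sup>2) powr Re b / ?s\<^sup>2"
    using s by (simp add: powr_diff)
  have "((\<lambda>\<theta>. weight_const b * exp (- Im b * \<theta>)) has_real_derivative
      weight_const b * exp (- Im b * \<theta>) * - Im b) (at \<theta>)"
    by (auto intro!: derivative_eq_intros)
  from DERIV_mult[OF this D] show ?thesis
    unfolding circle_weight_def[abs_def] p using s
    by (rule_tac DERIV_cong) (auto simp: field_simps power2_eq_square)
qed

lemma cis_minus_1: "cis \<theta> - 1 = 2 * \<i> * of_real (sin (\<theta> / 2)) * cis (\<theta> / 2)"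
proof -
  have "cis \<theta> = cis (\<theta> / 2) * cis (\<theta> / 2)" by (simp add: cis_mult)
  then have c: "cos \<theta> = (cos (\<theta> / 2))\<^sup>2 - (sin (\<theta> / 2))\<^sup>2"
    and s: "sin \<theta> = 2 * (sin (\<theta> / 2) * cos (\<theta> / 2))"
    by (simp_all add: complex_eq_iff power2_eq_square)
  from c have "cos \<theta> = 1 - 2 * (sin (\<theta> / 2))\<^sup>2"
    by (simp only: cos_squared_eq)
  with s show ?thesis
    by (simp add: complex_eq_iff power2_eq_square)
qed

text \<open>The factor \<open>z - 1\<close> cancels the pole of the logarithmic derivative of the weight at \<open>z = 1\<close>
  and leaves a polynomial of degree one.\<close>

lemma circle_weight_pearson:
  assumes "sin (\<theta> / 2) \<noteq> 0"
  shows "(cis \<theta> - 1) * of_real (Re b * cos (\<theta> / 2) / sin (\<theta> / 2) - Im b)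
    = \<i> * (b * cis \<theta> + cnj b)"
proof -
  let ?u = "cis (\<theta> / 2)"
  have "(cis \<theta> - 1) * of_real (Re b * cos (\<theta> / 2) / sin (\<theta> / 2) - Im b)
      = 2 * \<i> * ?u * (of_real (sin (\<theta> / 2))
          * of_real (Re b * cos (\<theta> / 2) / sin (\<theta> / 2) - Im b))"
    by (subst cis_minus_1) (simp add: mult.assoc mult.left_commute)
  also have "of_real (sin (\<theta> / 2)) * of_real (Re b * cos (\<theta> / 2) / sin (\<theta> / 2) - Im b)
      = complex_of_real (Re (b * ?u))"
    using assms unfolding of_real_mult[symmetric] by (simp add: field_simps)
  also have "2 * \<i> * ?u * \<dots> = \<i> * ?u * (b * ?u + cnj (b * ?u))"
    by (simp only: complex_add_cnj) simp
  also have "\<dots> = \<i> * (b * (?u * ?u) + cnj b * (?u * cnj ?u))"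
    by (simp add: algebra_simps)
  also have "?u * ?u = cis \<theta>" by (simp add: cis_mult)
  also have "?u * cnj ?u = 1" by (simp add: cis_cnj cis_mult)
  finally show ?thesis by simp
qed

lemma has_vector_derivative_cis:
  "((\<lambda>\<theta>. cis (c * \<theta>)) has_vector_derivative \<i> * of_real c * cis (c * \<theta>)) (at \<theta>)"
proof -
  have "((\<lambda>z. exp (\<i> * of_real c * z)) has_field_derivative
      exp (\<i> * of_real c * of_real \<theta>) * (\<i> * of_real c)) (at (of_real \<theta>))"
    by (rule derivative_eq_intros refl | simp)+
  from has_vector_derivative_real_field[OF this] show ?thesis
    by (simp add: cis_conv_exp mult_ac)
qed

lemma has_vector_derivative_poly_cis:
  "((\<lambda>\<theta>. poly q (cis \<theta>)) has_vector_derivative \<i> * cis \<theta> * poly (pderiv q) (cis \<theta>)) (at \<theta>)"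
  using field_vector_diff_chain_at[OF has_vector_derivative_cis[of 1 \<theta>], of "poly q"]
    poly_DERIV[of q "cis \<theta>"] by (simp add: o_def)

text \<open>On \<open>[0, 2 pi]\<close> the function is a continuous multiple of \<open>(sin\<^sup>2 (\<theta>/2)) powr (Re b + 1/2)\<close>,
  whose exponent is positive. Hence it tends to \<open>0\<close> at both ends, and the integration by parts
  below has no boundary terms.\<close>

lemma continuous_cis_minus_1_circle_weight:
  assumes "Re b > - 1 / 2"
  shows "continuous_on {0..2 * pi} (\<lambda>\<theta>. (cis \<theta> - 1) * of_real (circle_weight b \<theta>))"
proof -
  let ?h = "\<lambda>\<theta>. 2 * \<i> * cis (\<theta> / 2) * of_real (weight_const b * exp (- Im b * \<theta>))"
  let ?P = "\<lambda>\<theta>. ((sin (\<theta> / 2))\<^sup>2) powr (Re b + 1 / 2)"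
  let ?g = "\<lambda>\<theta>. ?h \<theta> * of_real (?P \<theta>)"
  have "continuous_on {0..2 * pi} ?h"
    by (intro continuous_intros) auto
  moreover have "continuous_on {0..2 * pi} ?P"
    using assms by (intro continuous_on_sine_powr) simp
  ultimately have "continuous_on {0..2 * pi} ?g"
    by (rule continuous_on_mult[OF _ continuous_on_of_real])
  also have "?this \<longleftrightarrow> ?thesis"
  proof (rule continuous_on_cong)
    fix \<theta> :: real assume "\<theta> \<in> {0..2 * pi}"
    then have "sin (\<theta> / 2) \<ge> 0" by (intro sin_ge_zero) auto
    then have "((sin (\<theta> / 2))\<^sup>2) powr (Re b + 1 / 2)
        = sin (\<theta> / 2) * ((sin (\<theta> / 2))\<^sup>2) powr Re b"
      by (simp add: powr_add)
    then show "?g \<theta> = (cis \<theta> - 1) * of_real (circle_weight b \<theta>)"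
      by (simp add: cis_minus_1 circle_weight_def mult_ac)
  qed simp
  finally show ?thesis .
qed

text \<open>By the product rule and the Pearson equation, the \<open>\<theta>\<close>-derivative of
  \<open>(z - 1) p(z) cnj z ^ k w(\<theta>)\<close> is \<open>\<i> R(z) cnj z ^ k w(\<theta>)\<close> with the polynomial \<open>R\<close> below, so
  \<open>R\<close> is orthogonal to \<open>z ^ k\<close>.\<close>

lemma circle_weight_integration_by_parts:
  assumes b: "Re b > - 1 / 2"
  defines "ip \<equiv> \<lambda>p q. circle_inner (circle_weight b) (poly p) (poly q)"
  shows "ip ([:0, -1, 1:] * pderiv p) (monom 1 k)
      = (of_nat k - 1 - b) * ip (pCons 0 p) (monom 1 k) - (of_nat k + cnj b) * ip p (monom 1 k)"
proof -
  interpret W: positive_circle_weight "circle_weight b"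
    using b by (rule positive_circle_weight_circle_weight)
  let ?w = "\<lambda>\<theta>. complex_of_real (circle_weight b \<theta>)"
  let ?H = "\<lambda>\<theta>. poly p (cis \<theta>) * cis (- real k * \<theta>)"
  let ?F = "\<lambda>\<theta>. (cis \<theta> - 1) * ?w \<theta> * ?H \<theta>"
  define R where "R = [:0, -1, 1:] * pderiv p + (smult (1 + b - of_nat k) (pCons 0 p)
      + smult (of_nat k + cnj b) p)"
  let ?f = "\<lambda>\<theta>. poly R (cis \<theta>) * cnj (poly (monom 1 k) (cis \<theta>)) * ?w \<theta>"
  have conj_pow: "cnj (poly (monom 1 k) (cis \<theta>)) = cis (- real k * \<theta>)" for \<theta>
    by (simp only: poly_monom mult_1 Complex.DeMoivre cis_cnj mult_minus_left)
  have "((\<lambda>\<theta>. \<i> * ?f \<theta>) has_integral (?F (2 * pi) - ?F 0)) {0..2 * pi}"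
  proof (rule fundamental_theorem_of_calculus_interior)
    show "continuous_on {0..2 * pi} ?F"
      by (intro continuous_on_mult[OF continuous_cis_minus_1_circle_weight[OF b]]
            continuous_intros)
    fix \<theta> assume "\<theta> \<in> {0<..<2 * pi}"
    then have \<theta>: "0 < \<theta>" "\<theta> < 2 * pi" by auto
    then have s: "sin (\<theta> / 2) > 0" by (intro sin_gt_zero) auto
    let ?L = "complex_of_real (Re b * cos (\<theta> / 2) / sin (\<theta> / 2) - Im b)"
    let ?z = "cis \<theta>" and ?v = "cis (- real k * \<theta>)"
    have dz: "((\<lambda>\<theta>. cis \<theta> - 1) has_vector_derivative \<i> * ?z) (at \<theta>)"
      using has_vector_derivative_diff[OF has_vector_derivative_cis[of 1 \<theta>] has_vector_derivative_const[of 1]]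
      by simp
    have dw: "(?w has_vector_derivative ?w \<theta> * ?L) (at \<theta>)"
      by (rule has_vector_derivative_of_real[OF circle_weight_DERIV[OF \<theta>], of b, unfolded of_real_mult])
    have dv: "((\<lambda>\<theta>. cis (- real k * \<theta>)) has_vector_derivative - (\<i> * of_nat k * ?v)) (at \<theta>)"
      using has_vector_derivative_cis[of "- real k" \<theta>] by simp
    have "(?F has_vector_derivative
        ((?z - 1) * ?w \<theta>) * (poly p ?z * - (\<i> * of_nat k * ?v)
            + \<i> * ?z * poly (pderiv p) ?z * ?v)
        + ((?z - 1) * (?w \<theta> * ?L) + \<i> * ?z * ?w \<theta>) * (poly p ?z * ?v)) (at \<theta>)"
      by (intro has_vector_derivative_mult dz dw dv has_vector_derivative_poly_cis)
    also have "((?z - 1) * (?w \<theta> * ?L) + \<i> * ?z * ?w \<theta>)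
        = ?w \<theta> * ((?z - 1) * ?L) + \<i> * ?z * ?w \<theta>"
      by (simp only: mult_ac)
    also have "(?z - 1) * ?L = \<i> * (b * ?z + cnj b)"
      using s by (intro circle_weight_pearson) simp
    also have "?w \<theta> * (\<i> * (b * ?z + cnj b)) + \<i> * ?z * ?w \<theta>
        = \<i> * ?w \<theta> * (b * ?z + cnj b + ?z)"
      by (simp add: algebra_simps)
    also have "((?z - 1) * ?w \<theta>) * (poly p ?z * - (\<i> * of_nat k * ?v)
            + \<i> * ?z * poly (pderiv p) ?z * ?v)
        + \<i> * ?w \<theta> * (b * ?z + cnj b + ?z) * (poly p ?z * ?v) = \<i> * ?f \<theta>"
      unfolding conj_pow R_def by (simp add: algebra_simps)
    finally show "(?F has_vector_derivative \<i> * ?f \<theta>) (at \<theta>)" .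
  qed simp
  moreover have "?F (2 * pi) - ?F 0 = 0"
    by simp
  ultimately have "((\<lambda>\<theta>. \<i> * ?f \<theta>) has_integral 0) {0..2 * pi}"
    by (simp only:)
  from has_integral_mult_right[OF this, of "- \<i>"] have "(?f has_integral 0) {0..2 * pi}"
    by (simp add: mult.assoc[symmetric])
  then have "integral {0..2 * pi} ?f = 0"
    by (rule integral_unique)
  then have "W.ip R (monom 1 k) = 0"
    unfolding W.ip_def circle_inner_def
    by (subst set_borel_integral_eq_integral(2)[OF W.integrable_ip])
  then have "W.ip ([:0, -1, 1:] * pderiv p) (monom 1 k)
      = (of_nat k - 1 - b) * W.ip (pCons 0 p) (monom 1 k) - (of_nat k + cnj b) * W.ip p (monom 1 k)"
    unfolding R_def W.ip_add_left W.ip_smult_left by (simp add: algebra_simps add_eq_0_iff)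
  then show ?thesis by (simp only: W.ip_def ip_def)
qed

theorem theorem4p1:
  fixes \<eta> lam :: real and b :: complex
    and \<Phi> :: "nat \<Rightarrow> complex poly" and \<alpha> :: "nat \<Rightarrow> complex"
  assumes "lam > - 1 / 2"
    and "b = complex_of_real lam + \<i> * complex_of_real \<eta>"
    and "monic_opuc (circle_weight b) \<Phi>"
    and "\<alpha> = verblunsky \<Phi>"
  shows "\<forall>n\<ge>2. \<forall>z.
     (z - 1) * poly (pderiv (\<Phi> n)) z =
       - (cnj b + of_nat n) * (1 - of_real ((cmod (\<alpha> (n - 1)))\<^sup>2)) * poly (\<Phi> (n - 1)) z
       + of_nat n * poly (\<Phi> n) z
   \<and> (\<forall>r. (z - 1) * (z - r) * poly (pderiv (\<Phi> n)) z =
       of_nat n * poly (\<Phi> (n + 1)) z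
       - (cnj b + of_nat n * (r + 1)) * poly (\<Phi> n) z
       + r * (cnj b + of_nat n) * (1 - of_real ((cmod (\<alpha> (n - 1)))\<^sup>2)) * poly (\<Phi> (n - 1)) z
       - (b + 1) * cnj (\<alpha> n) * poly (reciprocal_poly (\<Phi> n)) z)
   \<and> z * (z - 1) * poly (pderiv (\<Phi> n)) z =
       of_nat n * poly (\<Phi> (n + 1)) z
       - (cnj b + of_nat n) * poly (\<Phi> n) z
       - (b + 1) * cnj (\<alpha> n) * poly (reciprocal_poly (\<Phi> n)) z
   \<and> (z - 1)\<^sup>2 * poly (pderiv (\<Phi> n)) z =
       of_nat n * poly (\<Phi> (n + 1)) z
       - (cnj b + 2 * of_nat n) * poly (\<Phi> n) z
       + (cnj b + of_nat n) * (1 - of_real ((cmod (\<alpha> (n - 1)))\<^sup>2)) * poly (\<Phi> (n - 1)) z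
       - (b + 1) * cnj (\<alpha> n) * poly (reciprocal_poly (\<Phi> n)) z
   \<and> (z\<^sup>2 - 1) * poly (pderiv (\<Phi> n)) z =
       of_nat n * poly (\<Phi> (n + 1)) z
       - cnj b * poly (\<Phi> n) z
       - (cnj b + of_nat n) * (1 - of_real ((cmod (\<alpha> (n - 1)))\<^sup>2)) * poly (\<Phi> (n - 1)) z
       - (b + 1) * cnj (\<alpha> n) * poly (reciprocal_poly (\<Phi> n)) z"
proof -
  have Re: "Re b > - 1 / 2" using assms(1,2) by simp
  interpret positive_circle_weight "circle_weight b"
    using Re by (rule positive_circle_weight_circle_weight)
  interpret pearson_orthogonal_polys "circle_weight b" \<Phi> b
    by unfold_locales (fact assms(3), unfold ip_def, rule circle_weight_integration_by_parts[OF Re])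
  show ?thesis
  proof (intro allI impI, goal_cases)
    case (1 n z)
    then obtain m where n: "n = Suc m" by (cases n) auto
    let ?D = "poly (pderiv (\<Phi> n)) z"
    have D1: "(z - 1) * ?D =
       - (cnj b + of_nat n) * (1 - of_real ((cmod (\<alpha> (n - 1)))\<^sup>2)) * poly (\<Phi> (n - 1)) z
       + of_nat n * poly (\<Phi> n) z"
      using arg_cong[OF structure_relation_backward[of m], of "\<lambda>p. poly p z"]
      by (simp add: n assms(4) algebra_simps)
    have D2: "z * (z - 1) * ?D = of_nat n * poly (\<Phi> (n + 1)) z
       - (cnj b + of_nat n) * poly (\<Phi> n) z
       - (b + 1) * cnj (\<alpha> n) * poly (reciprocal_poly (\<Phi> n)) z"
      using arg_cong[OF structure_relation_forward[of n], of "\<lambda>p. poly p z"]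
      by (simp add: n assms(4) algebra_simps)
    have D3: "(z - 1) * (z - r) * ?D = of_nat n * poly (\<Phi> (n + 1)) z
       - (cnj b + of_nat n * (r + 1)) * poly (\<Phi> n) z
       + r * (cnj b + of_nat n) * (1 - of_real ((cmod (\<alpha> (n - 1)))\<^sup>2)) * poly (\<Phi> (n - 1)) z
       - (b + 1) * cnj (\<alpha> n) * poly (reciprocal_poly (\<Phi> n)) z" for r
    proof -
      have "(z - 1) * (z - r) * ?D = z * (z - 1) * ?D - r * ((z - 1) * ?D)"
        by (simp add: algebra_simps)
      then show ?thesis
        unfolding D1 D2 by (simp add: algebra_simps)
    qed
    have D4: "(z - 1)\<^sup>2 * ?D = of_nat n * poly (\<Phi> (n + 1)) z
       - (cnj b + 2 * of_nat n) * poly (\<Phi> n) z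
       + (cnj b + of_nat n) * (1 - of_real ((cmod (\<alpha> (n - 1)))\<^sup>2)) * poly (\<Phi> (n - 1)) z
       - (b + 1) * cnj (\<alpha> n) * poly (reciprocal_poly (\<Phi> n)) z"
      using D3[of 1] by (simp only: power2_eq_square) (simp add: mult.commute)
    have "(z\<^sup>2 - 1) * ?D = (z - 1) * (z - (- 1)) * ?D"
      by (simp add: power2_eq_square algebra_simps)
    then have D5: "(z\<^sup>2 - 1) * ?D = of_nat n * poly (\<Phi> (n + 1)) z
       - cnj b * poly (\<Phi> n) z
       - (cnj b + of_nat n) * (1 - of_real ((cmod (\<alpha> (n - 1)))\<^sup>2)) * poly (\<Phi> (n - 1)) z
       - (b + 1) * cnj (\<alpha> n) * poly (reciprocal_poly (\<Phi> n)) z"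
      by (simp only: D3[of "-1"]) (simp add: algebra_simps)
    show ?case
      by (intro conjI allI D1 D2 D3 D4 D5)
  qed
qed

end
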